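(* Let $(\{A_n\}_{n},\{\Psi_n\}_{n})$ be an operator-valued p-ASF in $\mathcal{B}(\mathcal{X},\mathcal{Y})$. Then an operator-valued p-ASF $(\{B_n\}_{n},\{\Phi_n\}_{n})$ in $\mathcal{B}(\mathcal{X},\mathcal{Y})$ is a dual for $(\{A_n\}_{n},\{\Psi_n\}_{n})$ if and only if there are bounded linear operators $U:\mathcal{X}\to\ell^p(\mathbb{N})\otimes\mathcal{Y}$ and $V:\ell^p(\mathbb{N})\otimes\mathcal{Y}\to\mathcal{X}$ with $$B_n=A_nS_{A,\Psi}^{-1}+\Gamma_nU-A_nS_{A,\Psi}^{-1}\theta_\Psi U,$$ $$\Phi_n=S_{A,\Psi}^{-1}\Psi_n+VL_n-V\theta_AS_{A,\Psi}^{-1}\Psi_n,\quad\forall n\in\mathbb{N},$$ such that the operator $$S_{A,\Psi}^{-1}+VU-V\theta_AS_{A,\Psi}^{-1}\theta_\Psi U$$ is bounded invertible.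
   Context: Banach spaces are over $\mathbb{K}=\mathbb{R}$ or $\mathbb{C}$; $\mathcal{X},\mathcal{Y}$ are Banach spaces, $p\in[1,\infty)$, $\mathcal{B}(\mathcal{X},\mathcal{Y})$ is the space of bounded linear operators. $\ell^p(\mathbb{N})\otimes\mathcal{Y}$ is the completion of the algebraic tensor product in a fixed cross norm ($\|a\otimes y\|=\|a\|\|y\|$) for which, for all $T\in\mathcal{B}(\ell^p(\mathbb{N}))$ and $R\in\mathcal{B}(\mathcal{Y})$, $T\otimes R$ extends to a bounded operator with $\|T\otimes R\|\le\|T\|\|R\|$. With $\{e_n\}_n$ the standard Schauder basis of $\ell^p(\mathbb{N})$, $L_n:\mathcal{Y}\to\ell^p(\mathbb{N})\otimes\mathcal{Y}$ is $L_ny=e_n\otimes y$, and $\Gamma_n:\ell^p(\mathbb{N})\otimes\mathcal{Y}\to\mathcal{Y}$ is the bounded linear operator with $\Gamma_n(\{a_m\}_m\otimes y)=a_ny$. Thus $\Gamma_nL_n=I_{\mathcal{Y}}$, $\Gamma_nL_m=0$ for $n\ne m$, and $\sum_{n=1}^\infty L_n\Gamma_nz=z$ for all $z$. For collections $\{A_n\}_{n}$ in $\mathcal{B}(\mathcal{X},\mathcal{Y})$ and $\{\Psi_n\}_{n}$ in $\mathcal{B}(\mathcal{Y},\mathcal{X})$, the pair is an operator-valued p-approximate Schauder frame (operator-valued p-ASF) in $\mathcal{B}(\mathcal{X},\mathcal{Y})$ if: (i) the frame operator $S_{A,\Psi}x=\sum_{n=1}^\infty\Psi_nA_nx$ is a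 well-defined bounded linear invertible operator on $\mathcal{X}$; (ii) the analysis operator $\theta_A:\mathcal{X}\to\ell^p(\mathbb{N})\otimes\mathcal{Y}$, $\theta_Ax=\sum_{n=1}^\infty L_nA_nx$, is a well-defined bounded linear operator; (iii) the synthesis operator $\theta_\Psi:\ell^p(\mathbb{N})\otimes\mathcal{Y}\to\mathcal{X}$, $\theta_\Psi z=\sum_{n=1}^\infty\Psi_n\Gamma_nz$, is a well-defined bounded linear operator. An operator-valued p-ASF $(\{B_n\}_{n},\{\Phi_n\}_{n})$ is a dual for $(\{A_n\}_{n},\{\Psi_n\}_{n})$ if $\theta_\Psi\theta_B=\theta_\Phi\theta_A=I_{\mathcal{X}}$, where $\theta_B$, $\theta_\Phi$ are the analysis and synthesis operators of $(\{B_n\}_{n},\{\Phi_n\}_{n})$. *)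

theory Defs
  imports "HOL-Analysis.Analysis"
begin

(* Banach spaces over K = R or C.  The scalar field is a type of class real_normed_field.  Both
   real and complex are instances and, by the Gelfand-Mazur theorem, there are no others up to
   isometric isomorphism.  The K-scalar multiplication is an explicit function, because the
   library's normed spaces carry only a real one. *)
locale banach_over = vector_space scale
  for scale :: "'k::real_normed_field \<Rightarrow> 'v::banach \<Rightarrow> 'v" +
  assumes norm_scale: "norm (scale k x) = norm k * norm x"
    and scale_of_real: "scale (of_real r) x = r *\<^sub>R x"

lemma banach_over_real: "banach_over (scaleR :: real \<Rightarrow> 'v::banach \<Rightarrow> 'v)"
  by unfold_locales (simp_all add: algebra_simps)

definition bounded_op ::
  "('k \<Rightarrow> 'v::real_normed_vector \<Rightarrow> 'v) \<Rightarrow> ('k \<Rightarrow> 'w::real_normed_vector \<Rightarrow> 'w)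
    \<Rightarrow> ('v \<Rightarrow> 'w) \<Rightarrow> bool" where
  "bounded_op sV sW f \<longleftrightarrow> bounded_linear f \<and> (\<forall>k x. f (sV k x) = sW k (f x))"

definition bounded_invertible_op ::
  "('k \<Rightarrow> 'v::real_normed_vector \<Rightarrow> 'v) \<Rightarrow> ('v \<Rightarrow> 'v) \<Rightarrow> bool" where
  "bounded_invertible_op sV f \<longleftrightarrow> bounded_op sV sV f \<and>
     (\<exists>g. bounded_op sV sV g \<and> g \<circ> f = id \<and> f \<circ> g = id)"

definition lp :: "real \<Rightarrow> (nat \<Rightarrow> 'k::real_normed_field) set" where
  "lp p = {a. summable (\<lambda>n. norm (a n) powr p)}"

definition lp_norm :: "real \<Rightarrow> (nat \<Rightarrow> 'k::real_normed_field) \<Rightarrow> real" where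
  "lp_norm p a = (\<Sum>n. norm (a n) powr p) powr (1 / p)"

definition lp_basis :: "nat \<Rightarrow> nat \<Rightarrow> 'k::real_normed_field" where
  "lp_basis n = (\<lambda>m. if m = n then 1 else 0)"

(* Only the values of T on lp p matter. *)
definition lp_bounded_op ::
  "real \<Rightarrow> ((nat \<Rightarrow> 'k::real_normed_field) \<Rightarrow> (nat \<Rightarrow> 'k)) \<Rightarrow> bool" where
  "lp_bounded_op p T \<longleftrightarrow>
     (\<forall>a\<in>lp p. T a \<in> lp p) \<and>
     (\<forall>a\<in>lp p. \<forall>b\<in>lp p. T (\<lambda>n. a n + b n) = (\<lambda>n. T a n + T b n)) \<and>
     (\<forall>k. \<forall>a\<in>lp p. T (\<lambda>n. k * a n) = (\<lambda>n. k * T a n)) \<and>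
     (\<exists>C. \<forall>a\<in>lp p. lp_norm p (T a) \<le> C * lp_norm p a)"

definition lp_onorm ::
  "real \<Rightarrow> ((nat \<Rightarrow> 'k::real_normed_field) \<Rightarrow> (nat \<Rightarrow> 'k)) \<Rightarrow> real" where
  "lp_onorm p T = (SUP a\<in>lp p. lp_norm p (T a) / lp_norm p a)"

(* The Banach space 'z together with the map tens (a, y) |-> a (x) y is a completion of the
   algebraic tensor product of lp p and 'y in a cross norm for which operators T (x) R extend with
   norm at most ||T|| ||R||.  The span of the elementary tensors is the algebraic tensor product:
   tens is bilinear and the factors are linearly disjoint under it (the last two implications;
   this is Treves' definition of the algebraic tensor product).  Completion means that this span
   is dense in the complete space 'z. *)
locale lp_tensor = Y: banach_over sY + Z: banach_over sZ
  for p :: real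
    and sY :: "'k::real_normed_field \<Rightarrow> 'y::banach \<Rightarrow> 'y"
    and sZ :: "'k \<Rightarrow> 'z::banach \<Rightarrow> 'z"
    and tens :: "(nat \<Rightarrow> 'k) \<Rightarrow> 'y \<Rightarrow> 'z" +
  assumes tens_add_left: "\<lbrakk>a \<in> lp p; b \<in> lp p\<rbrakk> \<Longrightarrow> tens (\<lambda>n. a n + b n) y = tens a y + tens b y"
    and tens_scale_left: "a \<in> lp p \<Longrightarrow> tens (\<lambda>n. k * a n) y = sZ k (tens a y)"
    and tens_add_right: "a \<in> lp p \<Longrightarrow> tens a (y + y') = tens a y + tens a y'"
    and tens_scale_right: "a \<in> lp p \<Longrightarrow> tens a (sY k y) = sZ k (tens a y)"
    and tens_disjoint_left: "\<And>r as ys.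
          \<lbrakk>\<forall>i<r. as i \<in> lp p; (\<Sum>i<r. tens (as i) (ys i)) = 0;
           \<forall>c :: nat \<Rightarrow> 'k. (\<forall>n. (\<Sum>i<r. c i * as i n) = 0) \<longrightarrow> (\<forall>i<r. c i = 0)\<rbrakk>
          \<Longrightarrow> \<forall>i<(r::nat). ys i = 0"
    and tens_disjoint_right: "\<And>r as ys.
          \<lbrakk>\<forall>i<r. as i \<in> lp p; (\<Sum>i<r. tens (as i) (ys i)) = 0;
           \<forall>c :: nat \<Rightarrow> 'k. (\<Sum>i<r. sY (c i) (ys i)) = 0 \<longrightarrow> (\<forall>i<r. c i = 0)\<rbrakk>
          \<Longrightarrow> \<forall>i<(r::nat). as i = (\<lambda>n. 0)"
    and tens_dense: "closure (Z.span {tens a y |a y. a \<in> lp p}) = UNIV"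
    and tens_cross_norm: "a \<in> lp p \<Longrightarrow> norm (tens a y) = lp_norm p a * norm y"
    and tens_op: "\<lbrakk>lp_bounded_op p T; bounded_op sY sY R\<rbrakk> \<Longrightarrow>
          \<exists>W. bounded_op sZ sZ W \<and> (\<forall>a\<in>lp p. \<forall>y. W (tens a y) = tens (T a) (R y)) \<and>
              onorm W \<le> lp_onorm p T * onorm R"

(* Sequences are indexed from 0 throughout. *)
definition L_op :: "((nat \<Rightarrow> 'k::real_normed_field) \<Rightarrow> 'y \<Rightarrow> 'z) \<Rightarrow> nat \<Rightarrow> 'y \<Rightarrow> 'z" where
  "L_op tens n y = tens (lp_basis n) y"

(* In lp_tensor with p \<ge> 1 such an operator exists and is unique: apply tens_op to the coordinate
   projections for existence and tens_dense for uniqueness. *)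
definition Gamma_op ::
  "real \<Rightarrow> ('k::real_normed_field \<Rightarrow> 'y::banach \<Rightarrow> 'y) \<Rightarrow> ('k \<Rightarrow> 'z::banach \<Rightarrow> 'z)
    \<Rightarrow> ((nat \<Rightarrow> 'k) \<Rightarrow> 'y \<Rightarrow> 'z) \<Rightarrow> nat \<Rightarrow> 'z \<Rightarrow> 'y" where
  "Gamma_op p sY sZ tens n =
     (THE G. bounded_op sZ sY G \<and> (\<forall>a\<in>lp p. \<forall>y. G (tens a y) = sY (a n) y))"

definition frame_op ::
  "(nat \<Rightarrow> 'x \<Rightarrow> 'y) \<Rightarrow> (nat \<Rightarrow> 'y \<Rightarrow> 'x::banach) \<Rightarrow> 'x \<Rightarrow> 'x" where
  "frame_op A \<Psi> x = (\<Sum>n. \<Psi> n (A n x))"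

definition analysis_op ::
  "((nat \<Rightarrow> 'k::real_normed_field) \<Rightarrow> 'y \<Rightarrow> 'z::banach) \<Rightarrow> (nat \<Rightarrow> 'x \<Rightarrow> 'y) \<Rightarrow> 'x \<Rightarrow> 'z" where
  "analysis_op tens A x = (\<Sum>n. L_op tens n (A n x))"

definition synthesis_op ::
  "real \<Rightarrow> ('k::real_normed_field \<Rightarrow> 'y::banach \<Rightarrow> 'y) \<Rightarrow> ('k \<Rightarrow> 'z::banach \<Rightarrow> 'z)
    \<Rightarrow> ((nat \<Rightarrow> 'k) \<Rightarrow> 'y \<Rightarrow> 'z) \<Rightarrow> (nat \<Rightarrow> 'y \<Rightarrow> 'x::banach) \<Rightarrow> 'z \<Rightarrow> 'x" where
  "synthesis_op p sY sZ tens \<Psi> z = (\<Sum>n. \<Psi> n (Gamma_op p sY sZ tens n z))"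

(* The summability clauses state well-definedness of the three series: suminf is total. *)
definition p_ASF ::
  "real \<Rightarrow> ('k::real_normed_field \<Rightarrow> 'x::banach \<Rightarrow> 'x) \<Rightarrow> ('k \<Rightarrow> 'y::banach \<Rightarrow> 'y)
    \<Rightarrow> ('k \<Rightarrow> 'z::banach \<Rightarrow> 'z) \<Rightarrow> ((nat \<Rightarrow> 'k) \<Rightarrow> 'y \<Rightarrow> 'z)
    \<Rightarrow> (nat \<Rightarrow> 'x \<Rightarrow> 'y) \<Rightarrow> (nat \<Rightarrow> 'y \<Rightarrow> 'x) \<Rightarrow> bool" where
  "p_ASF p sX sY sZ tens A \<Psi> \<longleftrightarrow>
     (\<forall>n. bounded_op sX sY (A n)) \<and> (\<forall>n. bounded_op sY sX (\<Psi> n)) \<and>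
     (\<forall>x. summable (\<lambda>n. \<Psi> n (A n x))) \<and>
     bounded_invertible_op sX (frame_op A \<Psi>) \<and>
     (\<forall>x. summable (\<lambda>n. L_op tens n (A n x))) \<and>
     bounded_op sX sZ (analysis_op tens A) \<and>
     (\<forall>z. summable (\<lambda>n. \<Psi> n (Gamma_op p sY sZ tens n z))) \<and>
     bounded_op sZ sX (synthesis_op p sY sZ tens \<Psi>)"

definition is_dual ::
  "real \<Rightarrow> ('k::real_normed_field \<Rightarrow> 'x::banach \<Rightarrow> 'x) \<Rightarrow> ('k \<Rightarrow> 'y::banach \<Rightarrow> 'y)
    \<Rightarrow> ('k \<Rightarrow> 'z::banach \<Rightarrow> 'z) \<Rightarrow> ((nat \<Rightarrow> 'k) \<Rightarrow> 'y \<Rightarrow> 'z)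
    \<Rightarrow> (nat \<Rightarrow> 'x \<Rightarrow> 'y) \<Rightarrow> (nat \<Rightarrow> 'y \<Rightarrow> 'x)
    \<Rightarrow> (nat \<Rightarrow> 'x \<Rightarrow> 'y) \<Rightarrow> (nat \<Rightarrow> 'y \<Rightarrow> 'x) \<Rightarrow> bool" where
  "is_dual p sX sY sZ tens B \<Phi> A \<Psi> \<longleftrightarrow>
     p_ASF p sX sY sZ tens B \<Phi> \<and>
     synthesis_op p sY sZ tens \<Psi> \<circ> analysis_op tens B = id \<and>
     synthesis_op p sY sZ tens \<Phi> \<circ> analysis_op tens A = id"

end

theory Submission
  imports Defs
begin

text \<open>
  Everything reduces to the coordinate maps \<open>\<Gamma> n\<close>. They are bounded operators with
  \<open>\<Gamma> n (L m y) = (if m = n then y else 0)\<close>, so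
  applying \<open>\<Gamma> n\<close> to the series \<open>\<theta>B x = (\<Sum>n. L n (B n x))\<close> returns
  \<open>B n x\<close>. Hence for any analysis sequence \<open>B\<close> and synthesis sequence \<open>\<Psi>\<close> the
  composition of the two operators is a mixed frame operator,
  \<open>\<theta>\<Psi> (\<theta>B x) = (\<Sum>n. \<Psi> n (B n x))\<close>, and in particular \<open>\<theta>\<Psi> \<circ> \<theta>A = S\<close>
  (lemma \<open>synthesis_analysis\<close>). Similarly \<open>\<theta>\<Psi> (L n y) = \<Psi> n y\<close>.

  If \<open>(B, \<Phi>)\<close> is dual to \<open>(A, \<Psi>)\<close>, then \<open>U = \<theta>B\<close> and \<open>V = \<theta>\<Phi>\<close>
  solve the two equations: duality makes the first and last terms of each right-hand side cancel,
  and what remains is \<open>\<Gamma> n (\<theta>B x) = B n x\<close>, respectively \<open>\<theta>\<Phi> (L n y) = \<Phi> n y\<close>.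
  In the same way the operator in the invertibility condition collapses to
  \<open>\<theta>\<Phi> \<circ> \<theta>B\<close>, the frame operator of \<open>(B, \<Phi>)\<close>.

  Conversely, insert the formula for \<open>B n\<close> into \<open>\<theta>\<Psi> (\<theta>B x) = (\<Sum>n. \<Psi> n (B n x))\<close>.
  Each of the three resulting series can be summed: the first gives \<open>S (S_inv x) = x\<close>, the
  second \<open>\<theta>\<Psi> (U x)\<close>, the third \<open>S (S_inv (\<theta>\<Psi> (U x)))\<close>, and the last two cancel.
  The computation of \<open>\<theta>\<Phi> (\<theta>A x)\<close> is the mirror image, with \<open>S_inv\<close>, \<open>V\<close> and
  \<open>V \<circ> \<theta>A \<circ> S_inv\<close> applied to convergent series.

  The analytic content is the existence of \<open>\<Gamma> n\<close>. The hypothesis on the cross norm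
  extends \<open>T \<otimes> I\<close>, with \<open>T\<close> the projection of \<open>lp p\<close> onto the \<open>n\<close>-th
  coordinate, to a bounded operator on the tensor product. Its values lie in the range of
  \<open>L n\<close>, which is an isometric and hence closed copy of \<open>'y\<close>, so it can be followed by the
  inverse of \<open>L n\<close>.
\<close>

section \<open>Sequences with one coordinate\<close>

lemma lp_norm_single:
  assumes "0 < p"
  shows "(\<lambda>m. if m = n then c else 0) \<in> lp p"
    and "lp_norm p (\<lambda>m. if m = n then c else 0) = norm c"
proof -
  have eq: "(\<lambda>m. norm (if m = n then c else 0) powr p) = (\<lambda>m. if m = n then norm c powr p else 0)"
    by auto
  have s: "(\<lambda>m. norm (if m = n then c else 0) powr p) sums (norm c powr p)"
    unfolding eq using sums_single[of n "\<lambda>_. norm c powr p"] by simp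
  then show "(\<lambda>m. if m = n then c else 0) \<in> lp p"
    by (simp add: lp_def sums_iff)
  show "lp_norm p (\<lambda>m. if m = n then c else 0) = norm c"
    using sums_unique[OF s, symmetric] assms by (simp add: lp_norm_def powr_powr)
qed

lemma norm_coordinate_le_lp_norm:
  assumes "0 < p" and "a \<in> lp p"
  shows "norm (a n) \<le> lp_norm p a"
proof -
  have "summable (\<lambda>n. norm (a n) powr p)"
    using assms by (simp add: lp_def)
  then have "norm (a n) powr p \<le> (\<Sum>n. norm (a n) powr p)"
    using sum_le_suminf[of "\<lambda>n. norm (a n) powr p" "{n}"] by simp
  then have "(norm (a n) powr p) powr (1 / p) \<le> lp_norm p a"
    unfolding lp_norm_def using assms by (intro powr_mono2) auto
  then show ?thesis using assms by (simp add: powr_powr)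
qed

lemma lp_bounded_op_coordinate_projection:
  assumes "0 < p"
  shows "lp_bounded_op p (\<lambda>a m. if m = n then a n else 0)"
  unfolding lp_bounded_op_def
  using assms
  by (auto simp: lp_norm_single fun_eq_iff
      intro!: exI[of _ 1] norm_coordinate_le_lp_norm)

section \<open>Coordinate maps on the tensor product\<close>

text \<open>Homogeneity over \<open>'k\<close> includes real homogeneity because \<open>scale\<close> restricts to
  \<open>scaleR\<close> on \<open>of_real\<close>.\<close>

lemma (in banach_over) bounded_op_scaleI:
  assumes "banach_over s'"
    and add: "\<And>x y. f (x + y) = f x + f y"
    and scale: "\<And>k x. f (scale k x) = s' k (f x)"
    and bound: "\<And>x. norm (f x) \<le> norm x * K"
  shows "bounded_op scale s' f"
proof -
  interpret t: banach_over s' by fact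
  show ?thesis
    unfolding bounded_op_def
  proof (intro conjI allI bounded_linear_intro[where K = K])
    show "f (r *\<^sub>R x) = r *\<^sub>R f x" for r x
      using scale[of "of_real r" x] by (simp add: scale_of_real t.scale_of_real)
  qed (fact add bound scale)+
qed

context lp_tensor
begin

text \<open>The induction principle that density of the elementary tensors provides: a property of
  vectors holds throughout once it is preserved by linear combinations and limits.\<close>

lemma closed_subspace_containing_tensors:
  assumes "closed S" and "Z.subspace S" and "\<And>a y. a \<in> lp p \<Longrightarrow> tens a y \<in> S"
  shows "z \<in> S"
proof -
  have "Z.span {tens a y |a y. a \<in> lp p} \<subseteq> S"
    using assms by (intro Z.span_minimal) auto
  then have "closure (Z.span {tens a y |a y. a \<in> lp p}) \<subseteq> S"
    using assms(1) by (rule closure_minimal)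
  then show ?thesis unfolding tens_dense by blast
qed

lemma bounded_op_eqI_on_tensors:
  assumes G: "bounded_op sZ s G" and H: "bounded_op sZ s H"
    and eq: "\<And>a y. a \<in> lp p \<Longrightarrow> G (tens a y) = H (tens a y)"
  shows "G = H"
proof
  fix z
  interpret G: bounded_linear G using G by (simp add: bounded_op_def)
  interpret H: bounded_linear H using H by (simp add: bounded_op_def)
  have "z \<in> {z. G z = H z}"
  proof (rule closed_subspace_containing_tensors)
    show "closed {z. G z = H z}"
      by (intro closed_Collect_eq G.continuous_on H.continuous_on continuous_on_id)
    show "Z.subspace {z. G z = H z}"
      using G H by (auto simp: Z.subspace_def G.add H.add G.zero H.zero bounded_op_def)
  qed (auto simp: eq)
  then show "G z = H z" by simp
qed

lemma L_op_isometry: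
  assumes "0 < p"
  shows "bounded_op sY sZ (L_op tens n)" and "norm (L_op tens n y) = norm y"
proof -
  have basis: "(lp_basis n :: nat \<Rightarrow> 'k) \<in> lp p" "lp_norm p (lp_basis n :: nat \<Rightarrow> 'k) = 1"
    using lp_norm_single[OF assms, where c = "1 :: 'k"] by (simp_all add: lp_basis_def)
  show iso: "norm (L_op tens n y) = norm y" for y
    by (simp add: L_op_def tens_cross_norm basis)
  show "bounded_op sY sZ (L_op tens n)"
    by (rule Y.bounded_op_scaleI[where K = 1])
      (simp_all add: Z.banach_over_axioms iso, simp_all add: L_op_def basis tens_add_right tens_scale_right)
qed

text \<open>The extension \<open>W\<close> of (coordinate projection) \<open>\<otimes>\<close> (identity) is \<open>L n \<circ> \<Gamma> n\<close> in
  disguise; completeness of \<open>'y\<close> keeps its values in the range of \<open>L n\<close> when passing from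
  sums of elementary tensors to limits.\<close>

lemma coordinate_map_exists:
  assumes "0 < p"
  shows "\<exists>G. bounded_op sZ sY G \<and> (\<forall>a\<in>lp p. \<forall>y. G (tens a y) = sY (a n) y)"
proof -
  let ?L = "L_op tens n" and ?T = "\<lambda>(a :: nat \<Rightarrow> 'k) m. if m = n then a n else 0"
  note basis = lp_norm_single(1)[OF assms, of n "1::'k", folded lp_basis_def]
  have "bounded_op sY sY (\<lambda>y. y)"
    by (simp add: bounded_op_def bounded_linear_ident)
  with tens_op[OF lp_bounded_op_coordinate_projection[OF assms, of n]]
  obtain W where W: "bounded_op sZ sZ W"
    and W_tens: "\<And>a y. a \<in> lp p \<Longrightarrow> W (tens a y) = tens (?T a) y"
    by blast
  interpret W: bounded_linear W using W by (simp add: bounded_op_def)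
  note L = L_op_isometry[OF assms, of n]
  interpret L: bounded_linear ?L using L(1) by (simp add: bounded_op_def)
  have L_scale: "?L (sY k y) = sZ k (?L y)" for k y
    using L(1) by (simp add: bounded_op_def)
  have W_scale: "W (sZ k z) = sZ k (W z)" for k z
    using W by (simp add: bounded_op_def)
  have W_L: "W (tens a y) = ?L (sY (a n) y)" if "a \<in> lp p" for a y
  proof -
    have "?T a = (\<lambda>m. a n * lp_basis n m)"
      by (auto simp: lp_basis_def)
    then show ?thesis
      using that basis by (simp add: W_tens tens_scale_left L_scale) (simp add: L_op_def)
  qed
  have "complete (range ?L)"
    by (rule complete_isometric_image[where e = 1]) (auto simp: L L.bounded_linear_axioms complete_UNIV)
  then have "closed (range ?L)"
    by (rule complete_imp_closed)
  have W_range: "z \<in> W -` range ?L" for z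
  proof (rule closed_subspace_containing_tensors)
    show "closed (W -` range ?L)"
      using \<open>closed (range ?L)\<close> by (intro closed_vimage W.continuous_on continuous_on_id)
    show "Z.subspace (W -` range ?L)"
      unfolding Z.subspace_def
    proof (intro conjI ballI allI)
      show "0 \<in> W -` range ?L"
        using L.zero by (auto simp: W.zero intro: range_eqI[of _ _ 0])
      show "z + z' \<in> W -` range ?L" if "z \<in> W -` range ?L" "z' \<in> W -` range ?L" for z z'
        using that by (auto simp: W.add simp flip: L.add)
      show "sZ k z \<in> W -` range ?L" if "z \<in> W -` range ?L" for k z
        using that by (auto simp: W_scale simp flip: L_scale)
    qed
  qed (simp add: W_L)
  have "inj ?L"
    unfolding linear_injective_0[OF L.linear] using L(2) by (metis norm_eq_zero)
  define G where "G z = inv ?L (W z)" for z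
  have LG: "?L (G z) = W z" for z
    using W_range[of z] by (simp add: G_def f_inv_into_f)
  have G_eqI: "G z = y" if "W z = ?L y" for z y
    using that \<open>inj ?L\<close> by (simp add: G_def)
  obtain K where "\<And>z. norm (W z) \<le> norm z * K"
    using W.bounded by blast
  then have "bounded_op sZ sY G"
    by (intro Z.bounded_op_scaleI[where K = K] Y.banach_over_axioms G_eqI)
      (simp_all add: L.add L_scale W.add W_scale LG flip: L(2))
  then show ?thesis
    using W_L G_eqI by blast
qed

lemma Gamma_op:
  assumes "0 < p"
  shows bounded_op_Gamma: "bounded_op sZ sY (Gamma_op p sY sZ tens n)"
    and Gamma_tens: "a \<in> lp p \<Longrightarrow> Gamma_op p sY sZ tens n (tens a y) = sY (a n) y"
proof -
  have "\<exists>!G. bounded_op sZ sY G \<and> (\<forall>a\<in>lp p. \<forall>y. G (tens a y) = sY (a n) y)"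
    using coordinate_map_exists[OF assms, of n]
    by (auto intro: bounded_op_eqI_on_tensors)
  from theI'[OF this, folded Gamma_op_def]
  show "bounded_op sZ sY (Gamma_op p sY sZ tens n)"
    and "a \<in> lp p \<Longrightarrow> Gamma_op p sY sZ tens n (tens a y) = sY (a n) y"
    by blast+
qed

lemma Gamma_L:
  assumes "0 < p"
  shows "Gamma_op p sY sZ tens n (L_op tens m y) = (if m = n then y else 0)"
  using Gamma_tens[OF assms lp_norm_single(1)[OF assms, of m "1::'k"], of n y]
  by (simp add: L_op_def lp_basis_def)

section \<open>Analysis and synthesis operators\<close>

lemma Gamma_analysis:
  assumes "0 < p" and "summable (\<lambda>n. L_op tens n (B n x))"
  shows "Gamma_op p sY sZ tens n (analysis_op tens B x) = B n x"
proof -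
  interpret G: bounded_linear "Gamma_op p sY sZ tens n"
    using bounded_op_Gamma[OF assms(1)] by (simp add: bounded_op_def)
  have "Gamma_op p sY sZ tens n (analysis_op tens B x) = (\<Sum>m. if m = n then B m x else 0)"
    unfolding analysis_op_def G.suminf[OF assms(2)] by (simp add: Gamma_L[OF assms(1)])
  also have "\<dots> = B n x"
    using sums_unique[OF sums_single[of n "\<lambda>m. B m x"]] by simp
  finally show ?thesis .
qed

text \<open>The two sequences need not belong to the same frame: duality compares \<open>\<Psi>\<close> with
  \<open>B\<close> and \<open>\<Phi>\<close> with \<open>A\<close>.\<close>

lemma synthesis_analysis:
  assumes "0 < p" and "\<And>x. summable (\<lambda>n. L_op tens n (B n x))"
    and "\<And>z. summable (\<lambda>n. \<Psi> n (Gamma_op p sY sZ tens n z))"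
  shows "(\<lambda>n. \<Psi> n (B n x)) sums synthesis_op p sY sZ tens \<Psi> (analysis_op tens B x)"
  using summable_sums[OF assms(3)[of "analysis_op tens B x"]]
  by (simp add: synthesis_op_def Gamma_analysis[OF assms(1,2)])

lemma synthesis_L:
  assumes "0 < p" and "\<And>n. \<Psi> n 0 = 0"
  shows "synthesis_op p sY sZ tens \<Psi> (L_op tens n y) = \<Psi> n y"
proof -
  have "(\<lambda>m. \<Psi> m (Gamma_op p sY sZ tens m (L_op tens n y))) = (\<lambda>m. if m = n then \<Psi> m y else 0)"
    using assms(2) by (auto simp: Gamma_L[OF assms(1)])
  then show ?thesis
    using sums_unique[OF sums_single[of n "\<lambda>m. \<Psi> m y"]] by (simp add: synthesis_op_def)
qed

end

section \<open>Duals of a frame\<close>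

theorem theorem3p6:
  fixes p :: real
    and sX :: "'k::real_normed_field \<Rightarrow> 'x::banach \<Rightarrow> 'x"
    and sY :: "'k \<Rightarrow> 'y::banach \<Rightarrow> 'y"
    and sZ :: "'k \<Rightarrow> 'z::banach \<Rightarrow> 'z"
    and tens :: "(nat \<Rightarrow> 'k) \<Rightarrow> 'y \<Rightarrow> 'z"
    and A B :: "nat \<Rightarrow> 'x \<Rightarrow> 'y"
    and \<Psi> \<Phi> :: "nat \<Rightarrow> 'y \<Rightarrow> 'x"
  defines "S_inv \<equiv> inv (frame_op A \<Psi>)"
    and "\<theta>A \<equiv> analysis_op tens A"
    and "\<theta>\<Psi> \<equiv> synthesis_op p sY sZ tens \<Psi>"
    and "L \<equiv> L_op tens"
    and "\<Gamma> \<equiv> Gamma_op p sY sZ tens"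
  assumes "1 \<le> p"
    and "banach_over sX"
    and "banach_over sY"
    and "lp_tensor p sY sZ tens"
    and "p_ASF p sX sY sZ tens A \<Psi>"
    and "p_ASF p sX sY sZ tens B \<Phi>"
  shows "is_dual p sX sY sZ tens B \<Phi> A \<Psi> \<longleftrightarrow>
    (\<exists>U V. bounded_op sX sZ U \<and> bounded_op sZ sX V \<and>
      (\<forall>n. B n = (\<lambda>x. A n (S_inv x) + \<Gamma> n (U x) - A n (S_inv (\<theta>\<Psi> (U x))))) \<and>
      (\<forall>n. \<Phi> n = (\<lambda>y. S_inv (\<Psi> n y) + V (L n y) - V (\<theta>A (S_inv (\<Psi> n y))))) \<and>
      bounded_invertible_op sX
        (\<lambda>x. S_inv x + V (U x) - V (\<theta>A (S_inv (\<theta>\<Psi> (U x))))))"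
proof -
  interpret lp_tensor p sY sZ tens by fact
  have p: "0 < p" using \<open>1 \<le> p\<close> by simp
  let ?S = "frame_op A \<Psi>"
    and ?\<theta>B = "analysis_op tens B" and ?\<theta>\<Phi> = "synthesis_op p sY sZ tens \<Phi>"

  note A\<Psi> = \<open>p_ASF p sX sY sZ tens A \<Psi>\<close>[unfolded p_ASF_def, folded \<theta>A_def \<theta>\<Psi>_def \<Gamma>_def L_def]
  note B\<Phi> = \<open>p_ASF p sX sY sZ tens B \<Phi>\<close>[unfolded p_ASF_def, folded \<Gamma>_def L_def]
  from A\<Psi> have bounded_A\<Psi>: "bounded_linear (\<Psi> n)" "bounded_linear \<theta>A" for n
    by (auto simp: bounded_op_def)
  from A\<Psi> have A_sum: "\<And>x. summable (\<lambda>n. L n (A n x))"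
    and \<Psi>_sum: "\<And>z. summable (\<lambda>n. \<Psi> n (\<Gamma> n z))"
    by auto
  from B\<Phi> have bounded_B\<Phi>: "bounded_op sX sZ ?\<theta>B" "bounded_op sZ sX ?\<theta>\<Phi>"
      "bounded_linear (\<Phi> n)" for n
    by (auto simp: bounded_op_def)
  from B\<Phi> have B_sum: "\<And>x. summable (\<lambda>n. L n (B n x))"
    and \<Phi>_sum: "\<And>z. summable (\<lambda>n. \<Phi> n (\<Gamma> n z))"
    by auto
  note mixed = synthesis_analysis[OF p, folded L_def \<Gamma>_def]

  have S_sums: "(\<lambda>n. \<Psi> n (A n x)) sums ?S x" for x
    using A\<Psi> by (simp add: frame_op_def summable_sums)
  obtain g where g: "bounded_op sX sX g" "g \<circ> ?S = id" "?S \<circ> g = id"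
    using A\<Psi> unfolding bounded_invertible_op_def by blast
  then have "S_inv = g"
    unfolding S_inv_def by (intro inv_unique_comp)
  then have S_inv: "bounded_linear S_inv" "\<And>x. S_inv (?S x) = x" "\<And>x. ?S (S_inv x) = x"
    using g by (simp_all add: bounded_op_def pointfree_idE)
  interpret S_inv: bounded_linear S_inv by fact

  show ?thesis
  proof
    assume "is_dual p sX sY sZ tens B \<Phi> A \<Psi>"
    then have dual: "\<theta>\<Psi> (?\<theta>B x) = x" "?\<theta>\<Phi> (\<theta>A x) = x" for x
      by (auto simp: is_dual_def \<theta>\<Psi>_def \<theta>A_def fun_eq_iff)
    have "B n = (\<lambda>x. A n (S_inv x) + \<Gamma> n (?\<theta>B x) - A n (S_inv (\<theta>\<Psi> (?\<theta>B x))))" for n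
      by (simp add: dual Gamma_analysis[OF p B_sum[unfolded L_def], folded \<Gamma>_def])
    moreover have "\<Phi> n = (\<lambda>y. S_inv (\<Psi> n y) + ?\<theta>\<Phi> (L n y) - ?\<theta>\<Phi> (\<theta>A (S_inv (\<Psi> n y))))" for n
      by (simp add: dual synthesis_L[OF p, where \<Psi> = \<Phi>, folded L_def]
          linear_simps(3)[OF bounded_B\<Phi>(3)])
    moreover have "bounded_invertible_op sX
        (\<lambda>x. S_inv x + ?\<theta>\<Phi> (?\<theta>B x) - ?\<theta>\<Phi> (\<theta>A (S_inv (\<theta>\<Psi> (?\<theta>B x)))))"
    proof -
      have "?\<theta>\<Phi> (?\<theta>B x) = frame_op B \<Phi> x" for x
        unfolding frame_op_def by (rule sums_unique[OF mixed[where B = B and \<Psi> = \<Phi>, OF B_sum \<Phi>_sum]])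
      then show ?thesis using B\<Phi> by (simp add: dual)
    qed
    ultimately show "\<exists>U V. bounded_op sX sZ U \<and> bounded_op sZ sX V \<and>
      (\<forall>n. B n = (\<lambda>x. A n (S_inv x) + \<Gamma> n (U x) - A n (S_inv (\<theta>\<Psi> (U x))))) \<and>
      (\<forall>n. \<Phi> n = (\<lambda>y. S_inv (\<Psi> n y) + V (L n y) - V (\<theta>A (S_inv (\<Psi> n y))))) \<and>
      bounded_invertible_op sX
        (\<lambda>x. S_inv x + V (U x) - V (\<theta>A (S_inv (\<theta>\<Psi> (U x)))))"
      using bounded_B\<Phi>(1,2) by (intro exI[of _ ?\<theta>B] exI[of _ ?\<theta>\<Phi>]) blast
  next
    assume "\<exists>U V. bounded_op sX sZ U \<and> bounded_op sZ sX V \<and>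
      (\<forall>n. B n = (\<lambda>x. A n (S_inv x) + \<Gamma> n (U x) - A n (S_inv (\<theta>\<Psi> (U x))))) \<and>
      (\<forall>n. \<Phi> n = (\<lambda>y. S_inv (\<Psi> n y) + V (L n y) - V (\<theta>A (S_inv (\<Psi> n y))))) \<and>
      bounded_invertible_op sX
        (\<lambda>x. S_inv x + V (U x) - V (\<theta>A (S_inv (\<theta>\<Psi> (U x)))))"
    then obtain U V where "bounded_op sZ sX V"
      and B: "\<And>n. B n = (\<lambda>x. A n (S_inv x) + \<Gamma> n (U x) - A n (S_inv (\<theta>\<Psi> (U x))))"
      and \<Phi>: "\<And>n. \<Phi> n = (\<lambda>y. S_inv (\<Psi> n y) + V (L n y) - V (\<theta>A (S_inv (\<Psi> n y))))"
      by blast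
    then interpret V: bounded_linear V by (simp add: bounded_op_def)
    interpret \<theta>A: bounded_linear \<theta>A by (fact bounded_A\<Psi>)
    have "\<theta>\<Psi> (?\<theta>B x) = x" for x
    proof -
      have "(\<lambda>n. \<Psi> n (\<Gamma> n (U x))) sums \<theta>\<Psi> (U x)"
        using \<Psi>_sum by (simp add: \<theta>\<Psi>_def synthesis_op_def \<Gamma>_def summable_sums)
      then have "(\<lambda>n. \<Psi> n (A n (S_inv x)) + \<Psi> n (\<Gamma> n (U x)) - \<Psi> n (A n (S_inv (\<theta>\<Psi> (U x)))))
          sums (?S (S_inv x) + \<theta>\<Psi> (U x) - ?S (S_inv (\<theta>\<Psi> (U x))))"
        by (intro sums_add sums_diff S_sums)
      then have "(\<lambda>n. \<Psi> n (B n x)) sums x"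
        by (simp add: B S_inv linear_simps[OF bounded_A\<Psi>(1)])
      with mixed[where B = B and \<Psi> = \<Psi>, OF B_sum \<Psi>_sum, of x] show ?thesis
        unfolding \<theta>\<Psi>_def by (rule sums_unique2)
    qed
    moreover have "?\<theta>\<Phi> (\<theta>A x) = x" for x
    proof -
      have "(\<lambda>n. L n (A n x)) sums \<theta>A x"
        using A_sum by (simp add: \<theta>A_def analysis_op_def L_def summable_sums)
      then have "(\<lambda>n. S_inv (\<Psi> n (A n x)) + V (L n (A n x)) - V (\<theta>A (S_inv (\<Psi> n (A n x)))))
          sums (S_inv (?S x) + V (\<theta>A x) - V (\<theta>A (S_inv (?S x))))"
        by (intro sums_add sums_diff S_sums S_inv.sums V.sums \<theta>A.sums)
      then have "(\<lambda>n. \<Phi> n (A n x)) sums x"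
        by (simp add: \<Phi> S_inv)
      with mixed[where B = A and \<Psi> = \<Phi>, OF A_sum \<Phi>_sum, of x] show ?thesis
        unfolding \<theta>A_def by (rule sums_unique2)
    qed
    ultimately show "is_dual p sX sY sZ tens B \<Phi> A \<Psi>"
      using \<open>p_ASF p sX sY sZ tens B \<Phi>\<close>
      by (auto simp: is_dual_def \<theta>\<Psi>_def \<theta>A_def fun_eq_iff)
  qed
qed

end
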